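(* Let $G$ be a strictly unimodal uniform grid with associated integer $N$. For any proper weight-determined set $E\subsetneq[0,N]$ (identified with $\underline{E}\subsetneq G$), $$\mathrm{cert\text{-}deg}(\underline{E})=\mathsf{PC}_G(E)=\min\{d\in[0,N]:E\text{ is }d\text{-admitting}\}.$$
   Context: For integers $a\le b$, $[a,b]$ denotes the set of integers $t$ with $a\le t\le b$ (and $[a,b]=\emptyset$ if $a>b$); $[n]=[1,n]$. A uniform grid is a set $G=[0,k_1-1]\times\cdots\times[0,k_n-1]\subseteq\mathbb{R}^n$ with $n\ge1$ and integers $k_i\ge2$; put $N=\sum_{i\in[n]}(k_i-1)$. The weight of $x\in G$ is $\mathrm{wt}(x)=\sum_{i\in[n]}x_i$. A subset $S\subseteq G$ is weight-determined if $x\in S$, $y\in G$, $\mathrm{wt}(y)=\mathrm{wt}(x)$ imply $y\in S$. Weight-determined sets correspond one-to-one to subsets $E\subseteq[0,N]$ via $E\mapsto\underline{E}=\{x\in G:\mathrm{wt}(x)\in E\}$, and $E$ is identified with $\underline{E}$; write $\underline{j}=\underline{\{j\}}$. The grid $G$ is strictly unimodal if $|\underline{0}|<|\underline{1}|<\cdots<|\underline{\lfloor N/2\rfloor}|=|\underline{\lceil N/2\rceil}|>\cdots>|\underline{N}|$. A polynomial $f\in\mathbb{R}[X_1,\ldots,X_n]$ is a certifying polynomial for $S\subseteq G$ if $f$ is nonconstant as a function on $G$ but $f|_S$ is constant. The certifying degree $\mathrm{cert\text{-}deg}(S)$ is the smallest $d\in[0,N]$ such that $S$ has a certifying polynomial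 of degree at most $d$. $\mathsf{PC}_G(E)$ is the minimum degree of a polynomial $P\in\mathbb{R}[X_1,\ldots,X_n]$ that vanishes at every point of $\underline{E}$ but does not vanish at every point of $G$. For $i\in[0,N]$ let $T_{N,i}=[0,i-1]\cup[N-i+1,N]$ (so $T_{N,0}=\emptyset$). For $d,i\in[0,N]$ with $i\le d$, a set $E\subseteq[0,N]$ is $(d,i)$-admitting if $E\cup T_{N,i}\ne[0,N]$ and $|E\setminus T_{N,i}|\le d-i$. $E$ is $d$-admitting if it is $(d,i)$-admitting for some $i\in[0,d]$.
   Formalization: The equality cert-deg(E) = PC_G(E) is stated only for nonempty E, since for E = ∅ it fails (PC_G(∅) = 0 but a certifying polynomial must be nonconstant, so cert-deg ≥ 1); the equality of PC_G(E) with the minimum is stated for all proper E, including ∅. *)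

theory Defs
  imports "HOL-Analysis.Analysis" "HOL-Library.Poly_Mapping"
begin

(* Points of the grid are integer vectors, represented as functions nat => nat supported
   (extensionally) on the index set {1..n}; the embedding into R^n is the coercion real. *)

definition grid :: "nat \<Rightarrow> (nat \<Rightarrow> nat) \<Rightarrow> (nat \<Rightarrow> nat) set" where
  "grid n k = (\<Pi>\<^sub>E i\<in>{1..n}. {0..k i - 1})"

definition grid_N :: "nat \<Rightarrow> (nat \<Rightarrow> nat) \<Rightarrow> nat" where
  "grid_N n k = (\<Sum>i\<in>{1..n}. k i - 1)"

definition uniform_grid :: "nat \<Rightarrow> (nat \<Rightarrow> nat) \<Rightarrow> bool" where
  "uniform_grid n k \<longleftrightarrow> n \<ge> 1 \<and> (\<forall>i\<in>{1..n}. k i \<ge> 2)"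

definition wt :: "nat \<Rightarrow> (nat \<Rightarrow> nat) \<Rightarrow> nat" where
  "wt n x = (\<Sum>i\<in>{1..n}. x i)"

definition weight_set :: "nat \<Rightarrow> (nat \<Rightarrow> nat) \<Rightarrow> nat set \<Rightarrow> (nat \<Rightarrow> nat) set" where
  "weight_set n k E = {x \<in> grid n k. wt n x \<in> E}"

definition strictly_unimodal :: "nat \<Rightarrow> (nat \<Rightarrow> nat) \<Rightarrow> bool" where
  "strictly_unimodal n k \<longleftrightarrow>
     (let N = grid_N n k; w = (\<lambda>j. card (weight_set n k {j})) in
       (\<forall>j < N div 2. w j < w (Suc j)) \<and>
       w (N div 2) = w ((N + 1) div 2) \<and>
       (\<forall>j. (N + 1) div 2 \<le> j \<and> j < N \<longrightarrow> w j > w (Suc j)))"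

(* Multivariate real polynomials: finitely supported maps from exponent vectors to coefficients.
   R[X_1,...,X_n] is the subset of those polynomials whose variables have indices in {1..n}. *)

type_synonym mpoly = "(nat \<Rightarrow>\<^sub>0 nat) \<Rightarrow>\<^sub>0 real"

definition mpolys :: "nat \<Rightarrow> mpoly set" where
  "mpolys n = {p. \<forall>m\<in>Poly_Mapping.keys p. Poly_Mapping.keys m \<subseteq> {1..n}}"

definition mono_degree :: "(nat \<Rightarrow>\<^sub>0 nat) \<Rightarrow> nat" where
  "mono_degree m = (\<Sum>i\<in>Poly_Mapping.keys m. Poly_Mapping.lookup m i)"

(* The zero polynomial gets degree 0; it never occurs as a certifying polynomial
   nor as a polynomial that is nonzero somewhere on the grid. *)
definition total_degree :: "mpoly \<Rightarrow> nat" where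
  "total_degree p = Max (insert 0 (mono_degree ` Poly_Mapping.keys p))"

definition mpoly_eval :: "mpoly \<Rightarrow> (nat \<Rightarrow> real) \<Rightarrow> real" where
  "mpoly_eval p x =
     (\<Sum>m\<in>Poly_Mapping.keys p. Poly_Mapping.lookup p m *
        (\<Prod>i\<in>Poly_Mapping.keys m. x i ^ Poly_Mapping.lookup m i))"

definition grid_eval :: "mpoly \<Rightarrow> (nat \<Rightarrow> nat) \<Rightarrow> real" where
  "grid_eval p x = mpoly_eval p (\<lambda>i. real (x i))"

definition certifying :: "nat \<Rightarrow> (nat \<Rightarrow> nat) \<Rightarrow> (nat \<Rightarrow> nat) set \<Rightarrow> mpoly \<Rightarrow> bool" where
  "certifying n k S f \<longleftrightarrow>
     f \<in> mpolys n \<and> \<not> grid_eval f constant_on grid n k \<and> grid_eval f constant_on S"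

definition cert_deg :: "nat \<Rightarrow> (nat \<Rightarrow> nat) \<Rightarrow> (nat \<Rightarrow> nat) set \<Rightarrow> nat" where
  "cert_deg n k S =
     (LEAST d. d \<in> {0..grid_N n k} \<and> (\<exists>f. certifying n k S f \<and> total_degree f \<le> d))"

definition PC :: "nat \<Rightarrow> (nat \<Rightarrow> nat) \<Rightarrow> nat set \<Rightarrow> nat" where
  "PC n k E =
     (LEAST d. \<exists>P \<in> mpolys n. total_degree P = d \<and>
        (\<forall>x\<in>weight_set n k E. grid_eval P x = 0) \<and> (\<exists>x\<in>grid n k. grid_eval P x \<noteq> 0))"

definition T_set :: "nat \<Rightarrow> nat \<Rightarrow> nat set" where
  "T_set N i = {0..<i} \<union> {N + 1 - i..N}"

definition admitting_at :: "nat \<Rightarrow> nat \<Rightarrow> nat \<Rightarrow> nat set \<Rightarrow> bool" where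
  "admitting_at N d i E \<longleftrightarrow> E \<union> T_set N i \<noteq> {0..N} \<and> card (E - T_set N i) \<le> d - i"

definition admitting :: "nat \<Rightarrow> nat \<Rightarrow> nat set \<Rightarrow> bool" where
  "admitting N d E \<longleftrightarrow> (\<exists>i\<in>{0..d}. admitting_at N d i E)"

(* A certifying polynomial has positive degree, even for the empty set; on the other hand
   the empty set is 0-admitting and PC of it is 0. *)
lemma certifying_degree_pos:
  assumes "certifying n k S f"
  shows "total_degree f > 0"
proof (rule ccontr)
  assume "\<not> total_degree f > 0"
  then have "\<forall>m\<in>Poly_Mapping.keys f. mono_degree m \<le> 0"
    unfolding total_degree_def
    by (metis (no_types, lifting) Max_ge finite_imageI finite_insert finite_keys gr0I imageI insertCI)
  then have "\<forall>m\<in>Poly_Mapping.keys f. mono_degree m = 0" by simp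
  then have key: "Poly_Mapping.keys m = {}" if "m \<in> Poly_Mapping.keys f" for m
    proof -
    have "(\<Sum>i\<in>Poly_Mapping.keys m. Poly_Mapping.lookup m i) = 0"
      using \<open>\<forall>m\<in>Poly_Mapping.keys f. mono_degree m = 0\<close> that
      unfolding mono_degree_def by blast
    then have "\<forall>i\<in>Poly_Mapping.keys m. Poly_Mapping.lookup m i = 0" by simp
    then show ?thesis by (metis ex_in_conv in_keys_iff)
  qed
  have "grid_eval f x = (\<Sum>m\<in>Poly_Mapping.keys f. Poly_Mapping.lookup f m)" for x
    unfolding grid_eval_def mpoly_eval_def by (intro sum.cong refl) (simp only: key prod.empty mult_1_right)
  then have "grid_eval f constant_on grid n k"
    unfolding constant_on_def by blast
  with assms show False unfolding certifying_def by blast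
qed

lemma admitting_empty: "admitting N 0 {}"
  unfolding admitting_def admitting_at_def T_set_def by auto

end

theory Submission
  imports Defs
begin

text \<open>Lower bound: a polynomial function \<open>f\<close> of degree \<open>d\<close> that is nonzero on the grid but vanishes on the
  weights in \<open>E\<close> is either a polynomial in the weight, which has at most \<open>d\<close> zeros, or a suitable
  \<open>f(x + e\<^sub>u) - f(x + e\<^sub>v)\<close> is nonzero on a smaller box and allows induction; \<open>i\<close> counts these steps.
  Upper bound: strict unimodality gives more coefficients for combinations \<open>f\<close> of the products
  \<open>\<Prod>\<^sub>j (x\<^sub>j choose m\<^sub>j)\<close> with \<open>wt m = i\<close> than points of weight \<open>N + 1 - i\<close>, so some \<open>f \<noteq> 0\<close> vanishes on that
  layer. Since \<open>\<Sum>\<^sub>j y\<^sub>j f(y - e\<^sub>j) = (wt y - i) f(y)\<close>, the function \<open>f\<close> vanishes exactly on the layers in \<open>T\<^bsub>N,i\<^esub>\<close>, and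
  \<open>f\<close> is multiplied by the factors \<open>wt - e\<close> for the remaining \<open>e \<in> E\<close>.\<close>

section \<open>Polynomial functions of bounded degree\<close>

text \<open>Degree enters only as an upper bound and polynomials only as functions, so closure
  properties follow by rule induction without handling coefficients.\<close>

inductive poly_fun :: "nat \<Rightarrow> nat \<Rightarrow> ((nat \<Rightarrow> nat) \<Rightarrow> real) \<Rightarrow> bool" for n where
  const: "poly_fun n d (\<lambda>_. c)"
| add: "poly_fun n d f \<Longrightarrow> poly_fun n d g \<Longrightarrow> poly_fun n d (\<lambda>x. f x + g x)"
| var_mult: "poly_fun n d f \<Longrightarrow> u \<in> {1..n} \<Longrightarrow> poly_fun n (Suc d) (\<lambda>x. real (x u) * f x)"

lemma poly_fun_mono: "poly_fun n d f \<Longrightarrow> d \<le> e \<Longrightarrow> poly_fun n e f"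
proof (induction arbitrary: e rule: poly_fun.induct)
  case (var_mult d f u)
  then obtain e' where "e = Suc e'" "d \<le> e'" by (cases e) auto
  with var_mult show ?case by (auto intro: poly_fun.var_mult)
qed (auto intro: poly_fun.intros)

lemma poly_fun_cmult: "poly_fun n d f \<Longrightarrow> poly_fun n d (\<lambda>x. c * f x)"
proof (induction rule: poly_fun.induct)
  case (const d a)
  show ?case by (rule poly_fun.const)
next
  case (add d f g)
  then show ?case by (simp add: distrib_left poly_fun.add)
next
  case (var_mult d f u)
  then show ?case using poly_fun.var_mult[of n d "\<lambda>x. c * f x" u] by (simp add: mult.left_commute)
qed

lemma poly_fun_mult:
  "poly_fun n d f \<Longrightarrow> poly_fun n e g \<Longrightarrow> poly_fun n (d + e) (\<lambda>x. f x * g x)"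
proof (induction rule: poly_fun.induct)
  case (const d a)
  then show ?case using poly_fun_mono[OF poly_fun_cmult] by simp
next
  case (add d f g')
  then show ?case by (simp add: distrib_right poly_fun.add)
next
  case (var_mult d f u)
  then show ?case
    using poly_fun.var_mult[of n "d + e" "\<lambda>x. f x * g x" u] by (simp add: mult.assoc)
qed

lemma poly_fun_sum:
  "(\<And>a. a \<in> A \<Longrightarrow> poly_fun n d (f a)) \<Longrightarrow> poly_fun n d (\<lambda>x. \<Sum>a\<in>A. f a x)"
proof (induction A rule: infinite_finite_induct)
  case (insert a A)
  then show ?case using poly_fun.add[of n d "f a" "\<lambda>x. \<Sum>a\<in>A. f a x"] by simp
qed (auto intro: poly_fun.const)

lemma poly_fun_prod:
  "(\<And>a. a \<in> A \<Longrightarrow> poly_fun n (e a) (f a)) \<Longrightarrow>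
    poly_fun n (\<Sum>a\<in>A. e a) (\<lambda>x. \<Prod>a\<in>A. f a x)"
proof (induction A rule: infinite_finite_induct)
  case (insert a A)
  then show ?case
    using poly_fun_mult[of n "e a" "f a" "sum e A" "\<lambda>x. \<Prod>a\<in>A. f a x"] by simp
qed (auto intro: poly_fun.const)

lemma poly_fun_var: "u \<in> {1..n} \<Longrightarrow> poly_fun n 1 (\<lambda>x. real (x u))"
  using poly_fun.var_mult[OF poly_fun.const[of n 0 1]] by simp

lemma poly_fun_power: "u \<in> {1..n} \<Longrightarrow> poly_fun n e (\<lambda>x. real (x u) ^ e)"
  by (induction e) (auto intro: poly_fun.intros)

lemma of_nat_binomial_Suc:
  "real (a choose Suc m) = (real a - real m) * real (a choose m) / real (Suc m)"
proof -
  have "Suc m * (a choose Suc m) = (a - m) * (a choose m)"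
    by (metis binomial_absorb_comp binomial_absorption mult.commute)
  \<comment> \<open>For \<open>a < m\<close> truncated and real subtraction differ, but the factor
    \<open>a choose m\<close> is then zero.\<close>
  moreover have "real ((a - m) * (a choose m)) = (real a - real m) * real (a choose m)"
    by (cases "m \<le> a") (auto simp: of_nat_diff)
  ultimately show ?thesis
    by (metis nonzero_mult_div_cancel_left of_nat_mult of_nat_0_eq_iff nat.distinct(1))
qed

lemma poly_fun_binomial: "u \<in> {1..n} \<Longrightarrow> poly_fun n m (\<lambda>x. real (x u choose m))"
proof (induction m)
  case (Suc m)
  have "poly_fun n 1 (\<lambda>x. real (x u) + - real m)"
    by (intro poly_fun.add poly_fun_var poly_fun.const Suc.prems)
  from poly_fun_cmult[OF poly_fun_mult[OF this Suc.IH[OF Suc.prems]], of "1 / real (Suc m)"]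
  show ?case unfolding of_nat_binomial_Suc by simp
qed (auto intro: poly_fun.const)

lemma poly_fun_wt: "poly_fun n 1 (\<lambda>x. real (wt n x))"
  unfolding wt_def of_nat_sum by (intro poly_fun_sum poly_fun_var)

section \<open>Polynomial functions versus finitely supported coefficient maps\<close>

lemma total_degree_le_iff: "total_degree p \<le> d \<longleftrightarrow> (\<forall>m\<in>Poly_Mapping.keys p. mono_degree m \<le> d)"
  unfolding total_degree_def by simp

lemma mono_degree_superset:
  assumes "finite S" "Poly_Mapping.keys m \<subseteq> S"
  shows "mono_degree m = (\<Sum>i\<in>S. Poly_Mapping.lookup m i)"
  unfolding mono_degree_def using assms
  by (intro sum.mono_neutral_left) (auto simp: in_keys_iff)

lemma grid_eval_superset:
  assumes "finite S" "Poly_Mapping.keys p \<subseteq> S"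
  shows "grid_eval p x = (\<Sum>m\<in>S. Poly_Mapping.lookup p m *
           (\<Prod>i\<in>Poly_Mapping.keys m. real (x i) ^ Poly_Mapping.lookup m i))"
  unfolding grid_eval_def mpoly_eval_def using assms
  by (intro sum.mono_neutral_left) (auto simp: in_keys_iff)

lemma grid_eval_zero [simp]: "grid_eval 0 x = 0"
  by (simp add: grid_eval_def mpoly_eval_def)

lemma grid_eval_add: "grid_eval (p + q) x = grid_eval p x + grid_eval q x"
proof -
  let ?S = "Poly_Mapping.keys p \<union> Poly_Mapping.keys q"
  have "Poly_Mapping.keys (p + q) \<subseteq> ?S" by (rule Poly_Mapping.keys_add)
  then show ?thesis
    by (simp add: grid_eval_superset[of ?S] lookup_add distrib_right sum.distrib)
qed

lemma grid_eval_sum: "grid_eval (\<Sum>a\<in>A. p a) x = (\<Sum>a\<in>A. grid_eval (p a) x)"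
  by (induction A rule: infinite_finite_induct) (auto simp: grid_eval_add)

lemma grid_eval_single:
  "grid_eval (Poly_Mapping.single m c) x =
    c * (\<Prod>i\<in>Poly_Mapping.keys m. real (x i) ^ Poly_Mapping.lookup m i)"
  by (subst grid_eval_superset[of "{m}"]) auto

lemma keys_sum_single:
  "Poly_Mapping.keys (\<Sum>a\<in>A. Poly_Mapping.single (g a) (c a)) \<subseteq> g ` A"
proof (induction A rule: infinite_finite_induct)
  case (insert a A)
  then show ?case
    using Poly_Mapping.keys_add[of "Poly_Mapping.single (g a) (c a)"
        "\<Sum>a\<in>A. Poly_Mapping.single (g a) (c a)"]
    by (auto split: if_splits)
qed auto

text \<open>Only multiplication by a variable needs work: it shifts every exponent vector by a unit
  vector and so raises each monomial degree by one.\<close>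

lemma ex_mpoly_if_poly_fun:
  "poly_fun n d f \<Longrightarrow> \<exists>p\<in>mpolys n. total_degree p \<le> d \<and> (\<forall>x. grid_eval p x = f x)"
proof (induction rule: poly_fun.induct)
  case (const d c)
  show ?case
    by (rule bexI[of _ "Poly_Mapping.single 0 c"])
      (auto simp: total_degree_le_iff mono_degree_def mpolys_def grid_eval_single split: if_splits)
next
  case (add d f g)
  then obtain p q where p: "p \<in> mpolys n" "total_degree p \<le> d" "\<And>x. grid_eval p x = f x"
    and q: "q \<in> mpolys n" "total_degree q \<le> d" "\<And>x. grid_eval q x = g x" by blast
  have "Poly_Mapping.keys (p + q) \<subseteq> Poly_Mapping.keys p \<union> Poly_Mapping.keys q"
    by (rule Poly_Mapping.keys_add)
  with p q have "p + q \<in> mpolys n" "total_degree (p + q) \<le> d"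
    unfolding mpolys_def total_degree_le_iff by blast+
  with p q show ?case by (intro bexI[of _ "p + q"]) (auto simp: grid_eval_add)
next
  case (var_mult d f u)
  then obtain p where p: "p \<in> mpolys n" "total_degree p \<le> d" "\<And>x. grid_eval p x = f x" by blast
  define e where "e = Poly_Mapping.single u (1::nat)"
  define q where "q = (\<Sum>m\<in>Poly_Mapping.keys p. Poly_Mapping.single (m + e) (Poly_Mapping.lookup p m))"
  have e: "Poly_Mapping.keys e \<subseteq> {1..n}" using var_mult.hyps by (auto simp: e_def)
  have keysp: "Poly_Mapping.keys m \<subseteq> {1..n}" if "m \<in> Poly_Mapping.keys p" for m
    using p(1) that by (auto simp: mpolys_def)
  have keyse: "Poly_Mapping.keys (m + e) \<subseteq> {1..n}" if "m \<in> Poly_Mapping.keys p" for m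
    using keysp[OF that] e Poly_Mapping.keys_add[of m e] by blast
  have lookup_e: "Poly_Mapping.lookup e i = (if i = u then 1 else 0)" for i
    by (auto simp: e_def lookup_single when_def)
  have deg: "mono_degree (m + e) = Suc (mono_degree m)" if "m \<in> Poly_Mapping.keys p" for m
    using mono_degree_superset[OF _ keysp[OF that]] mono_degree_superset[OF _ keyse[OF that]] var_mult.hyps
    by (simp add: lookup_add sum.distrib lookup_e)
  have ev: "(\<Prod>i\<in>Poly_Mapping.keys (m + e). real (x i) ^ Poly_Mapping.lookup (m + e) i) =
      real (x u) * (\<Prod>i\<in>Poly_Mapping.keys m. real (x i) ^ Poly_Mapping.lookup m i)"
    if m: "m \<in> Poly_Mapping.keys p" for m and x :: "nat \<Rightarrow> nat"
  proof -
    have sup: "(\<Prod>i\<in>Poly_Mapping.keys l. real (x i) ^ Poly_Mapping.lookup l i) =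
        (\<Prod>i\<in>{1..n}. real (x i) ^ Poly_Mapping.lookup l i)" if "Poly_Mapping.keys l \<subseteq> {1..n}" for l
      using that by (intro prod.mono_neutral_left) (auto simp: in_keys_iff)
    have "(\<Prod>i\<in>{1..n}. real (x i) ^ Poly_Mapping.lookup e i) = (\<Prod>i\<in>{1..n}. if i = u then real (x i) else 1)"
      by (intro prod.cong) (auto simp: lookup_e)
    also have "\<dots> = real (x u)" using var_mult.hyps by (simp add: prod.delta)
    finally show ?thesis
      unfolding sup[OF keysp[OF m]] sup[OF keyse[OF m]]
      by (simp add: lookup_add power_add prod.distrib mult.commute)
  qed
  have "Poly_Mapping.keys q \<subseteq> (\<lambda>m. m + e) ` Poly_Mapping.keys p"
    unfolding q_def by (rule keys_sum_single)
  then have "q \<in> mpolys n" "total_degree q \<le> Suc d"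
    using keyse deg p(2) by (auto simp: mpolys_def total_degree_le_iff)
  moreover have "grid_eval q x = real (x u) * f x" for x
  proof -
    have "grid_eval q x = (\<Sum>m\<in>Poly_Mapping.keys p. Poly_Mapping.lookup p m *
        (real (x u) * (\<Prod>i\<in>Poly_Mapping.keys m. real (x i) ^ Poly_Mapping.lookup m i)))"
      unfolding q_def grid_eval_sum grid_eval_single by (intro sum.cong refl) (simp add: ev)
    also have "\<dots> = real (x u) * grid_eval p x"
      by (simp add: grid_eval_superset[of "Poly_Mapping.keys p"] sum_distrib_left mult.left_commute)
    finally show ?thesis using p(3) by simp
  qed
  ultimately show ?case by blast
qed

lemma poly_fun_grid_eval:
  assumes "p \<in> mpolys n" "total_degree p \<le> d"
  shows "poly_fun n d (grid_eval p)"
proof -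
  have "poly_fun n d (\<lambda>x. \<Sum>m\<in>Poly_Mapping.keys p. Poly_Mapping.lookup p m *
      (\<Prod>i\<in>Poly_Mapping.keys m. real (x i) ^ Poly_Mapping.lookup m i))"
  proof (intro poly_fun_sum poly_fun_cmult)
    fix m assume m: "m \<in> Poly_Mapping.keys p"
    have "Poly_Mapping.keys m \<subseteq> {1..n}" using assms(1) m by (simp add: mpolys_def)
    then have "i \<in> {1..n}" if "i \<in> Poly_Mapping.keys m" for i using that by (rule subsetD)
    then have "poly_fun n (mono_degree m) (\<lambda>x. \<Prod>i\<in>Poly_Mapping.keys m. real (x i) ^ Poly_Mapping.lookup m i)"
      unfolding mono_degree_def by (intro poly_fun_prod poly_fun_power)
    then show "poly_fun n d (\<lambda>x. \<Prod>i\<in>Poly_Mapping.keys m. real (x i) ^ Poly_Mapping.lookup m i)"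
      by (rule poly_fun_mono) (use assms(2) m in \<open>auto simp: total_degree_le_iff\<close>)
  qed
  then show ?thesis by (simp add: grid_eval_def[abs_def] mpoly_eval_def)
qed

section \<open>Finite differences\<close>

definition diff :: "'a \<Rightarrow> (('a \<Rightarrow> nat) \<Rightarrow> real) \<Rightarrow> ('a \<Rightarrow> nat) \<Rightarrow> real" where
  "diff u f x = f (x(u := Suc (x u))) - f x"

text \<open>Vanishing of all \<open>D\<close>-fold unit differences in the directions \<open>I\<close>
  serves as a coordinate-free form of ``degree less than \<open>D\<close>''.\<close>

primrec diffs_vanish :: "'a set \<Rightarrow> nat \<Rightarrow> (('a \<Rightarrow> nat) \<Rightarrow> real) \<Rightarrow> bool" where
  "diffs_vanish I 0 f \<longleftrightarrow> (\<forall>x. f x = 0)"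
| "diffs_vanish I (Suc D) f \<longleftrightarrow> (\<forall>u\<in>I. diffs_vanish I D (diff u f))"

lemma diffs_vanish_zero: "diffs_vanish I D (\<lambda>_. 0)"
  by (induction D) (auto simp: diff_def[abs_def])

lemma diffs_vanish_add:
  "diffs_vanish I D f \<Longrightarrow> diffs_vanish I D g \<Longrightarrow> diffs_vanish I D (\<lambda>x. f x + g x)"
proof (induction D arbitrary: f g)
  case (Suc D)
  have "diff u (\<lambda>x. f x + g x) = (\<lambda>x. diff u f x + diff u g x)" for u
    by (auto simp: diff_def)
  with Suc show ?case by simp
qed simp

lemma diffs_vanish_minus:
  "diffs_vanish I D f \<Longrightarrow> diffs_vanish I D (\<lambda>x. - f x)"
proof (induction D arbitrary: f)
  case (Suc D)
  have "diff u (\<lambda>x. - f x) = (\<lambda>x. - diff u f x)" for u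
    by (auto simp: diff_def)
  with Suc show ?case by simp
qed simp

lemma diffs_vanish_Suc: "diffs_vanish I D f \<Longrightarrow> diffs_vanish I (Suc D) f"
proof (induction D arbitrary: f)
  case 0
  then show ?case by (simp add: diff_def)
qed simp

text \<open>The shifted function is \<open>f + diff v f\<close>, and both summands have vanishing
  differences of order \<open>D\<close>.\<close>

lemma diffs_vanish_shift:
  assumes "diffs_vanish I D f" "v \<in> I"
  shows "diffs_vanish I D (\<lambda>x. f (x(v := Suc (x v))))"
proof -
  have "diffs_vanish I D (diff v f)"
    using diffs_vanish_Suc[OF assms(1)] assms(2) by simp
  from diffs_vanish_add[OF assms(1) this] show ?thesis by (simp add: diff_def)
qed

text \<open>Discrete Leibniz rule: differencing \<open>x u * f\<close> in direction \<open>v\<close>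
  gives \<open>x u\<close> times the difference of \<open>f\<close>, plus a shifted copy of
  \<open>f\<close> when \<open>v = u\<close>.\<close>

lemma diffs_vanish_var_mult:
  "diffs_vanish I D f \<Longrightarrow> diffs_vanish I (Suc D) (\<lambda>x. real (x u) * f x)"
proof (induction D arbitrary: f)
  case 0
  then show ?case by (simp add: diff_def)
next
  case (Suc D)
  have "diffs_vanish I (Suc D) (diff v (\<lambda>x. real (x u) * f x))" if v: "v \<in> I" for v
  proof -
    have "diff v (\<lambda>x. real (x u) * f x) = (\<lambda>x. real (x u) * diff v f x +
        (if v = u then f (x(v := Suc (x v))) else 0))"
      by (auto simp: diff_def algebra_simps)
    moreover have "diffs_vanish I (Suc D) (\<lambda>x. real (x u) * diff v f x)"
      using Suc v by simp
    moreover have "diffs_vanish I (Suc D) (\<lambda>x. if v = u then f (x(v := Suc (x v))) else 0)"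
    proof (cases "v = u")
      case True
      show ?thesis unfolding if_P[OF True] by (rule diffs_vanish_shift[OF Suc.prems v])
    next
      case False
      show ?thesis unfolding if_not_P[OF False] by (rule diffs_vanish_zero)
    qed
    ultimately show ?thesis by (simp only: diffs_vanish_add)
  qed
  then show ?case by simp
qed

lemma diffs_vanish_poly_fun: "poly_fun n d f \<Longrightarrow> diffs_vanish {1..n} (Suc d) f"
proof (induction rule: poly_fun.induct)
  case (const d c)
  have "diff u (\<lambda>_. c) = (\<lambda>_. 0)" for u :: nat by (auto simp: diff_def)
  then show ?case by (simp add: diffs_vanish_zero)
qed (blast intro: diffs_vanish_add diffs_vanish_var_mult)+

section \<open>Functions of one integer variable\<close>

definition diff1 :: "(nat \<Rightarrow> real) \<Rightarrow> nat \<Rightarrow> real" where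
  "diff1 h t = h (Suc t) - h t"

text \<open>Newton's forward difference formula. The induction splits \<open>h (Suc s)\<close> into
  \<open>h s + diff1 h s\<close>, expands both terms and merges the coefficients by Pascal's
  rule.\<close>

lemma newton_forward: "h s = (\<Sum>j\<le>s. real (s choose j) * (diff1 ^^ j) h 0)"
proof (induction s arbitrary: h)
  case (Suc s)
  have *: "(diff1 ^^ j) (diff1 h) = (diff1 ^^ Suc j) h" for j
    by (simp add: funpow_swap1)
  have "h (Suc s) = h s + diff1 h s" by (simp add: diff1_def)
  also have "h s = (\<Sum>j\<le>Suc s. real (s choose j) * (diff1 ^^ j) h 0)"
    using Suc.IH[of h] by simp
  also have "\<dots> = h 0 + (\<Sum>j\<le>s. real (s choose Suc j) * (diff1 ^^ Suc j) h 0)"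
    by (subst sum.atMost_Suc_shift) simp
  also have "diff1 h s = (\<Sum>j\<le>s. real (s choose j) * (diff1 ^^ Suc j) h 0)"
    using Suc.IH[of "diff1 h"] unfolding * .
  finally have "h (Suc s) = h 0 + (\<Sum>j\<le>s. real (Suc s choose Suc j) * (diff1 ^^ Suc j) h 0)"
    by (simp add: algebra_simps sum.distrib del: funpow.simps)
  then show ?case by (subst sum.atMost_Suc_shift) (simp del: funpow.simps binomial_Suc_Suc)
qed simp

lemma ex_binomial_poly: "\<exists>p::real poly. degree p \<le> m \<and> (\<forall>t. poly p (real t) = real (t choose m))"
proof (induction m)
  case 0
  show ?case by (rule exI[of _ 1]) simp
next
  case (Suc m)
  then obtain p :: "real poly" where p: "degree p \<le> m" "\<And>t. poly p (real t) = real (t choose m)" by blast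
  let ?q = "smult (1 / real (Suc m)) ([:- real m, 1:] * p)"
  have "degree ([:- real m, 1:] * p) \<le> Suc m"
    using degree_mult_le[of "[:- real m, 1:]" p] p(1) by simp
  then have "degree ?q \<le> Suc m" using degree_smult_le order_trans by blast
  moreover have "poly ?q (real t) = real (t choose Suc m)" for t
    unfolding of_nat_binomial_Suc poly_smult poly_mult p(2) by simp
  ultimately show ?case by blast
qed

text \<open>Newton's expansion is cut off after \<open>D\<close>: for \<open>t \<le> N\<close> the
  omitted terms vanish by assumption, and surplus terms with \<open>j > t\<close> have a zero
  binomial coefficient.\<close>

lemma ex_poly_if_diff1_zero:
  assumes "\<And>j. D < j \<Longrightarrow> j \<le> N \<Longrightarrow> (diff1 ^^ j) h 0 = 0"
  shows "\<exists>p. degree p \<le> D \<and> (\<forall>t\<le>N. poly p (real t) = h t)"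
proof -
  obtain B :: "nat \<Rightarrow> real poly"
    where B: "\<And>m. degree (B m) \<le> m" "\<And>m t. poly (B m) (real t) = real (t choose m)"
    using ex_binomial_poly by metis
  define p where "p = (\<Sum>j\<le>D. smult ((diff1 ^^ j) h 0) (B j))"
  have "degree p \<le> D"
    unfolding p_def by (intro degree_sum_le) (auto intro: order_trans[OF degree_smult_le] order_trans[OF B(1)])
  moreover have "poly p (real t) = h t" if t: "t \<le> N" for t
  proof -
    have "poly p (real t) = (\<Sum>j\<le>D. real (t choose j) * (diff1 ^^ j) h 0)"
      unfolding p_def by (simp add: poly_sum B(2) mult.commute)
    also have "\<dots> = (\<Sum>j\<le>max D t. real (t choose j) * (diff1 ^^ j) h 0)"
    proof (intro sum.mono_neutral_left ballI)
      fix j assume "j \<in> {..max D t} - {..D}"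
      then show "real (t choose j) * (diff1 ^^ j) h 0 = 0"
        using assms[of j] t by (cases "j \<le> t") auto
    qed auto
    also have "\<dots> = (\<Sum>j\<le>t. real (t choose j) * (diff1 ^^ j) h 0)"
      by (intro sum.mono_neutral_right) auto
    finally show ?thesis using newton_forward[of h t] by simp
  qed
  ultimately show ?thesis by blast
qed

text \<open>On \<open>{0..N}\<close> the function agrees with a nonzero polynomial of degree at most
  \<open>D\<close>, whose roots are counted.\<close>

lemma card_zeros_le:
  assumes "\<And>j. D < j \<Longrightarrow> j \<le> N \<Longrightarrow> (diff1 ^^ j) h 0 = 0"
    and "t0 \<le> N" "h t0 \<noteq> 0"
  shows "card {t. t \<le> N \<and> h t = 0} \<le> D"
proof -
  obtain p where p: "degree p \<le> D" "\<And>t. t \<le> N \<Longrightarrow> poly p (real t) = h t"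
    using ex_poly_if_diff1_zero[of D N h, OF assms(1)] by blast
  have "p \<noteq> 0" using p(2)[of t0] assms(2,3) by auto
  have "card {t. t \<le> N \<and> h t = 0} = card (real ` {t. t \<le> N \<and> h t = 0})"
    by (intro card_image[symmetric]) (auto simp: inj_on_def)
  also have "\<dots> \<le> card {x. poly p x = 0}"
    using p(2) poly_roots_finite[OF \<open>p \<noteq> 0\<close>] by (intro card_mono) auto
  also have "\<dots> \<le> D"
    using card_poly_roots_bound[OF \<open>p \<noteq> 0\<close>] p(1) by linarith
  finally show ?thesis .
qed

section \<open>Boxes\<close>

abbreviation cells :: "'a set \<Rightarrow> ('a \<Rightarrow> nat) \<Rightarrow> ('a \<Rightarrow> nat) set" where
  "cells I b \<equiv> (\<Pi>\<^sub>E i\<in>I. {0..b i})"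

lemma finite_cells: "finite I \<Longrightarrow> finite (cells I b)"
  by (intro finite_PiE) auto

lemma sum_fun_upd:
  fixes x :: "'a \<Rightarrow> nat"
  assumes "finite I" "u \<in> I"
  shows "sum (x(u := a)) I + x u = sum x I + a"
proof -
  have "sum (x(u := a)) (I - {u}) = sum x (I - {u})" by (intro sum.cong) auto
  then show ?thesis using assms by (simp add: sum.remove[of I u])
qed

lemma sum_cells_le: "x \<in> cells I b \<Longrightarrow> sum x I \<le> sum b I"
  by (intro sum_mono) (auto simp: PiE_def Pi_def)

text \<open>Serves the inductions on differences: \<open>diff u f\<close> on the smaller box uses
  only values of \<open>f\<close> on the box \<open>b\<close>.\<close>

lemma cells_upd_Suc:
  assumes "x \<in> cells I (b(u := b u - 1))" "u \<in> I" "b u > 0"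
  shows "x \<in> cells I b" "x(u := Suc (x u)) \<in> cells I b"
proof -
  have le: "x i \<le> (if i = u then b u - 1 else b i)" if "i \<in> I" for i
    using assms(1) that by (fastforce simp: PiE_iff)
  have ex: "x \<in> extensional I" using assms(1) by (simp add: PiE_iff)
  have "x i \<le> b i" if "i \<in> I" for i using le[OF that] by (auto split: if_splits)
  with ex show "x \<in> cells I b" by (auto simp: PiE_iff)
  show "x(u := Suc (x u)) \<in> cells I b"
  proof (rule PiE_I)
    fix i assume "i \<in> I"
    from le[OF this] assms(3) show "(x(u := Suc (x u))) i \<in> {0..b i}" by (auto split: if_splits)
  qed (use ex assms(2) in \<open>auto simp: extensional_def\<close>)
qed

lemma cells_upd_less:
  assumes "x \<in> cells I b" "u \<in> I" "a \<le> b u"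
  shows "x(u := a) \<in> cells I b"
  using assms by (auto simp: PiE_iff extensional_def)

lemma ex_cells_sum:
  assumes "finite I" "t \<le> sum b I"
  shows "\<exists>x\<in>cells I b. sum x I = t"
  using assms(2)
proof (induction t)
  case 0
  show ?case by (rule bexI[of _ "\<lambda>i\<in>I. 0"]) auto
next
  case (Suc t)
  then obtain x where x: "x \<in> cells I b" "sum x I = t" by auto
  have "\<exists>u\<in>I. x u < b u"
  proof (rule ccontr)
    assume "\<not> (\<exists>u\<in>I. x u < b u)"
    then have "sum b I \<le> sum x I" by (intro sum_mono) force
    with x Suc.prems show False by simp
  qed
  then obtain u where u: "u \<in> I" "x u < b u" by blast
  with x show ?case
    using sum_fun_upd[OF assms(1) u(1), of x "Suc (x u)"]
    by (intro bexI[of _ "x(u := Suc (x u))"] cells_upd_less) (auto simp del: fun_upd_apply)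
qed

text \<open>Moving one unit of weight at a time connects any two points of equal weight.\<close>

lemma eq_if_swap_invariant:
  fixes f :: "('a \<Rightarrow> nat) \<Rightarrow> 'b"
  assumes fin: "finite I"
    and swap: "\<And>z u v. z \<in> cells I b \<Longrightarrow> u \<in> I \<Longrightarrow> v \<in> I \<Longrightarrow> u \<noteq> v \<Longrightarrow> z u < b u \<Longrightarrow> z v < b v \<Longrightarrow>
        f (z(u := Suc (z u))) = f (z(v := Suc (z v)))"
    and "x \<in> cells I b" "y \<in> cells I b" "sum x I = sum y I"
  shows "f x = f y"
  using assms(3-)
\<comment> \<open>The measure is the total excess of \<open>x\<close> over \<open>y\<close>; moving
  one unit from a coordinate \<open>u\<close> of excess to a coordinate \<open>v\<close> of deficit
  lowers it.\<close>
proof (induction "\<Sum>i\<in>I. x i - y i" arbitrary: x rule: less_induct)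
  case less
  show ?case
  proof (cases "\<forall>u\<in>I. x u \<le> y u")
    case True
    have "x u = y u" if "u \<in> I" for u
    proof (rule ccontr)
      assume "x u \<noteq> y u"
      with True that have "sum x I < sum y I" by (intro sum_strict_mono_ex1 fin) force+
      with less.prems show False by simp
    qed
    then have "x = y" using less.prems by (auto intro: PiE_ext)
    then show ?thesis by simp
  next
    case False
    then obtain u where u: "u \<in> I" "y u < x u" by force
    have "\<exists>v\<in>I. x v < y v"
    proof (rule ccontr)
      assume "\<not> (\<exists>v\<in>I. x v < y v)"
      with u have "sum y I < sum x I" by (intro sum_strict_mono_ex1 fin) force+
      with less.prems show False by simp
    qed
    then obtain v where v: "v \<in> I" "x v < y v" by blast
    have uv: "u \<noteq> v" using u v by auto
    have bds: "x u \<le> b u" "y v \<le> b v" using less.prems u v by (auto simp: PiE_iff)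
    \<comment> \<open>\<open>z\<close> lies one unit below both \<open>x\<close> and
      \<open>w\<close>, so \<open>swap\<close> applies at \<open>z\<close>.\<close>
    define z where "z = x(u := x u - 1)"
    define w where "w = z(v := Suc (z v))"
    have z: "z \<in> cells I b" unfolding z_def using less.prems u bds by (intro cells_upd_less) auto
    have "f (z(u := Suc (z u))) = f w"
      unfolding w_def using u v uv bds by (intro swap z) (auto simp: z_def)
    moreover have "z(u := Suc (z u)) = x" using u by (auto simp: z_def)
    moreover have "f w = f y"
    proof (rule less.hyps)
      show "w \<in> cells I b" unfolding w_def using v bds uv by (intro cells_upd_less z) (auto simp: z_def)
      show "sum w I = sum y I"
        using sum_fun_upd[OF fin u(1), of x "x u - 1", folded z_def]
          sum_fun_upd[OF fin v(1), of z "Suc (z v)", folded w_def] u less.prems by simp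
      show "(\<Sum>i\<in>I. w i - y i) < (\<Sum>i\<in>I. x i - y i)"
        using u v uv by (intro sum_strict_mono_ex1 fin) (auto simp: w_def z_def intro!: bexI[of _ u])
    qed (rule less.prems)
    ultimately show ?thesis by simp
  qed
qed

text \<open>If \<open>f\<close> depends on the weight only, then \<open>diff u f\<close> is
  \<open>diff1 h\<close> of the weight on the box shrunk at \<open>u\<close>. Each difference uses
  up one unit of the box, whence the bound on \<open>t + D\<close>.\<close>

lemma diff1_zero_if_diffs_vanish:
  assumes "finite I" "diffs_vanish I D f" "\<And>x. x \<in> cells I b \<Longrightarrow> f x = h (sum x I)" "t + D \<le> sum b I"
  shows "(diff1 ^^ D) h t = 0"
  using assms(2-)
proof (induction D arbitrary: f b h)
  case 0
  then show ?case using ex_cells_sum[OF assms(1), of t b] by auto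
next
  case (Suc D)
  from Suc.prems(3) have "sum b I \<noteq> 0" by simp
  then obtain u where u: "u \<in> I" "b u > 0" using assms(1) by auto
  let ?b = "b(u := b u - 1)"
  have "(diff1 ^^ D) (diff1 h) t = 0"
  proof (rule Suc.IH)
    show "diffs_vanish I D (diff u f)" using Suc.prems(1) u by simp
    show "diff u f x = diff1 h (sum x I)" if "x \<in> cells I ?b" for x
      using cells_upd_Suc[OF that u] sum_fun_upd[OF assms(1) u(1), of x "Suc (x u)"]
      by (simp add: Suc.prems(2) diff_def diff1_def del: fun_upd_apply)
    show "t + D \<le> sum ?b I"
      using sum_fun_upd[OF assms(1) u(1), of b "b u - 1"] Suc.prems(3) u by (simp del: fun_upd_apply)
  qed
  then show ?case by (simp add: funpow_swap1)
qed

text \<open>The hypothesis says that \<open>f\<close> vanishes on the top \<open>D\<close> weights \<open>sum b I + 1 - D, \<dots>, sum b I\<close>; its shape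
  avoids truncated subtraction.\<close>

lemma zero_if_zero_on_top:
  assumes "finite I" "diffs_vanish I D f"
    and "\<And>x. x \<in> cells I b \<Longrightarrow> sum b I < sum x I + D \<Longrightarrow> f x = 0"
    and "x \<in> cells I b"
  shows "f x = 0"
  using assms(2-)
proof (induction D arbitrary: f b x)
  case (Suc D)
  show ?case
    using Suc.prems(3)
  proof (induction "\<Sum>i\<in>I. b i - x i" arbitrary: x rule: less_induct)
    case less
    show ?case
    proof (cases "\<exists>u\<in>I. x u < b u")
      case True
      then obtain u where u: "u \<in> I" "x u < b u" by blast
      let ?b = "b(u := b u - 1)"
      have b: "Suc (sum ?b I) = sum b I"
        using sum_fun_upd[OF assms(1) u(1), of b "b u - 1"] u by (simp del: fun_upd_apply)
      \<comment> \<open>The top \<open>D\<close> weights of the shrunk box and their successors all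
        belong to the top \<open>Suc D\<close> weights of the original box.\<close>
      have "diff u f x = 0"
      proof (rule Suc.IH)
        show "diffs_vanish I D (diff u f)" using Suc.prems(1) u by simp
        show "x \<in> cells I ?b" using less.prems u by (auto simp: PiE_iff)
        show "diff u f y = 0" if y: "y \<in> cells I ?b" "sum ?b I < sum y I + D" for y
        proof -
          have "y \<in> cells I b" "y(u := Suc (y u)) \<in> cells I b" using cells_upd_Suc[OF y(1) u(1)] u by auto
          moreover have "sum b I < sum y I + Suc D" using y(2) b by simp
          moreover have "sum b I < sum (y(u := Suc (y u))) I + Suc D"
            using y(2) b sum_fun_upd[OF assms(1) u(1), of y "Suc (y u)"] by (simp del: fun_upd_apply)
          ultimately show ?thesis by (simp add: diff_def Suc.prems(2) del: fun_upd_apply)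
        qed
      qed
      moreover have "f (x(u := Suc (x u))) = 0"
      proof (rule less.hyps)
        show "(\<Sum>i\<in>I. b i - (x(u := Suc (x u))) i) < (\<Sum>i\<in>I. b i - x i)"
          using u by (intro sum_strict_mono_ex1 assms(1)) (auto intro!: bexI[of _ u])
        show "x(u := Suc (x u)) \<in> cells I b" using u less.prems by (intro cells_upd_less) auto
      qed
      ultimately show ?thesis by (simp add: diff_def del: fun_upd_apply)
    next
      case False
      then have "sum b I \<le> sum x I" by (intro sum_mono) force
      with less.prems show ?thesis by (intro Suc.prems(2)) auto
    qed
  qed
qed simp

section \<open>The lower bound\<close>

text \<open>Induction on \<open>d\<close>. If \<open>f\<close> depends on the weight only, it is a univariate polynomial in the weight,
  and counting its zeros gives \<open>i = 0\<close>. Otherwise some difference \<open>f(x + e\<^sub>u) - f(x + e\<^sub>v)\<close> is nonzero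
  on a box of total size smaller by 2, has smaller degree, and vanishes on the weights in \<open>E - 1\<close>.\<close>

lemma zero_weights_bound:
  assumes fin: "finite I" and "diffs_vanish I (Suc d) f"
    and "x0 \<in> cells I b" "f x0 \<noteq> 0" "\<And>x. x \<in> cells I b \<Longrightarrow> sum x I \<in> E \<Longrightarrow> f x = 0"
  shows "\<exists>i j. i \<le> j \<and> j + i \<le> sum b I \<and> j \<notin> E \<and> card (E \<inter> {i..sum b I - i}) + i \<le> d"
  using assms(2-)
proof (induction d arbitrary: f b E x0 rule: less_induct)
  case (less d)
  show ?case
  proof (cases "\<forall>z u v. z \<in> cells I b \<longrightarrow> u \<in> I \<longrightarrow> v \<in> I \<longrightarrow> u \<noteq> v \<longrightarrow> z u < b u \<longrightarrow> z v < b v \<longrightarrow>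
        f (z(u := Suc (z u))) = f (z(v := Suc (z v)))")
    case True
    \<comment> \<open>The value at one chosen point represents the whole layer, because
      \<open>f\<close> is invariant under moving a unit of weight.\<close>
    define h where "h t = f (SOME y. y \<in> cells I b \<and> sum y I = t)" for t
    have h: "f x = h (sum x I)" if x: "x \<in> cells I b" for x
    proof -
      define y where "y = (SOME y. y \<in> cells I b \<and> sum y I = sum x I)"
      have "y \<in> cells I b \<and> sum y I = sum x I"
        unfolding y_def by (rule someI[of _ x]) (use x in auto)
      then have y: "y \<in> cells I b" "sum x I = sum y I" by simp_all
      have "f x = f y"
        by (rule eq_if_swap_invariant[OF fin _ x y]) (use True in blast)
      then show ?thesis by (simp add: h_def y_def)
    qed
    have zero: "(diff1 ^^ j) h 0 = 0" if "d < j" "j \<le> sum b I" for j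
    proof -
      have "diffs_vanish I (Suc d + a) f" for a
        using less.prems(1) diffs_vanish_Suc by (induction a) (auto simp del: diffs_vanish.simps)
      from this[of "j - Suc d"] have "diffs_vanish I j f" using that by simp
      then show ?thesis
        by (rule diff1_zero_if_diffs_vanish[OF fin]) (use h that in auto)
    qed
    have x0: "sum x0 I \<le> sum b I" using less.prems(2) by (rule sum_cells_le)
    have "E \<inter> {0..sum b I} \<subseteq> {t. t \<le> sum b I \<and> h t = 0}"
    proof
      fix t assume t: "t \<in> E \<inter> {0..sum b I}"
      then obtain x where "x \<in> cells I b" "sum x I = t" using ex_cells_sum[OF fin, of t b] by auto
      with t less.prems(4)[of x] h[of x] show "t \<in> {t. t \<le> sum b I \<and> h t = 0}" by auto
    qed
    then have "card (E \<inter> {0..sum b I}) \<le> card {t. t \<le> sum b I \<and> h t = 0}"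
      by (intro card_mono) auto
    also have "\<dots> \<le> d"
      using card_zeros_le[OF zero x0] h less.prems(2,3) by auto
    finally have "card (E \<inter> {0..sum b I}) \<le> d" .
    moreover have "sum x0 I \<notin> E" using less.prems(2-4) by blast
    ultimately show ?thesis using x0 by (intro exI[of _ 0] exI[of _ "sum x0 I"]) simp
  next
    case False
    then obtain z u v where z: "z \<in> cells I b" and u: "u \<in> I" "z u < b u" and v: "v \<in> I" "z v < b v"
      and uv: "u \<noteq> v" and ne: "f (z(u := Suc (z u))) \<noteq> f (z(v := Suc (z v)))" by blast
    \<comment> \<open>The terms \<open>f x\<close> cancel, so \<open>g\<close> compares the two
      upper neighbours of \<open>x\<close>.\<close>
    define g where "g = (\<lambda>x. diff u f x + - diff v f x)"
    \<comment> \<open>Lowering the bounds at both \<open>u\<close> and \<open>v\<close> keeps both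
      neighbours inside the original box; the total drops by two.\<close>
    define b1 where "b1 = b(u := b u - 1)"
    define b2 where "b2 = b1(v := b1 v - 1)"
    have b1v: "b1 v = b v" using uv by (simp add: b1_def)
    have N: "sum b I = Suc (Suc (sum b2 I))"
      using sum_fun_upd[OF fin u(1), of b "b u - 1", folded b1_def]
        sum_fun_upd[OF fin v(1), of b1 "b1 v - 1", folded b2_def] u v b1v by simp
    have gd: "diffs_vanish I d g"
      unfolding g_def using less.prems(1) u v by (intro diffs_vanish_add diffs_vanish_minus) auto
    have gz: "g z \<noteq> 0" using ne by (simp add: g_def diff_def del: fun_upd_apply)
    then obtain d' where d: "d = Suc d'" using gd by (cases d) auto
    have zb: "z \<in> cells I b2" using z u v uv by (auto simp: PiE_iff b2_def b1_def)
    have gE: "g x = 0" if x: "x \<in> cells I b2" and "sum x I \<in> {e. Suc e \<in> E}" for x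
    proof -
      have x1: "x \<in> cells I b1" using cells_upd_Suc(1)[of x I b1 v] x v b1v by (auto simp: b2_def)
      have bc: "b2 = b(v := b v - 1, u := (b(v := b v - 1)) u - 1)"
        using uv by (auto simp: b2_def b1_def)
      have x2: "x \<in> cells I (b(v := b v - 1))"
        using cells_upd_Suc(1)[of x I "b(v := b v - 1)" u] x u uv bc by auto
      have "x(u := Suc (x u)) \<in> cells I b" using cells_upd_Suc(2)[of x I b u] x1 u by (auto simp: b1_def)
      moreover have "x(v := Suc (x v)) \<in> cells I b" using cells_upd_Suc(2)[of x I b v] x2 v by auto
      moreover have "sum (x(u := Suc (x u))) I = Suc (sum x I)" "sum (x(v := Suc (x v))) I = Suc (sum x I)"
        using sum_fun_upd[OF fin u(1), of x "Suc (x u)"] sum_fun_upd[OF fin v(1), of x "Suc (x v)"] by (simp_all del: fun_upd_apply)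
      ultimately show ?thesis using that(2) less.prems(4) by (simp add: g_def diff_def del: fun_upd_apply)
    qed
    from less.IH[of d' g z b2 "{e. Suc e \<in> E}"] gd gz zb gE d
    obtain i j where ij: "i \<le> j" "j + i \<le> sum b2 I" "Suc j \<notin> E"
      "card ({e. Suc e \<in> E} \<inter> {i..sum b2 I - i}) + i \<le> d'" by auto
    \<comment> \<open>Because the total dropped by two, the window for \<open>i\<close> in the small
      box, shifted up by one, is the window for \<open>Suc i\<close> in the original box.\<close>
    have "E \<inter> {Suc i..sum b I - Suc i} = Suc ` ({e. Suc e \<in> E} \<inter> {i..sum b2 I - i})"
    proof
      show "E \<inter> {Suc i..sum b I - Suc i} \<subseteq> Suc ` ({e. Suc e \<in> E} \<inter> {i..sum b2 I - i})"
      proof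
        fix e assume e: "e \<in> E \<inter> {Suc i..sum b I - Suc i}"
        then obtain e' where "e = Suc e'" by (cases e) auto
        with e N ij show "e \<in> Suc ` ({e. Suc e \<in> E} \<inter> {i..sum b2 I - i})" by auto
      qed
    qed (use N ij in auto)
    then have "card (E \<inter> {Suc i..sum b I - Suc i}) = card ({e. Suc e \<in> E} \<inter> {i..sum b2 I - i})"
      by (simp add: card_image)
    with ij N d show ?thesis by (intro exI[of _ "Suc i"] exI[of _ "Suc j"]) simp
  qed
qed

section \<open>The upper bound\<close>

text \<open>Gaussian elimination: an unknown \<open>a0\<close> with nonzero coefficient in equation
  \<open>b\<close> is eliminated from the other equations, and the reduced system has one equation
  and one unknown less.\<close>

lemma ex_nontrivial_solution:
  fixes M :: "'b \<Rightarrow> 'a \<Rightarrow> real"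
  assumes "finite B" "finite A" "card B < card A"
  shows "\<exists>c. (\<exists>a\<in>A. c a \<noteq> 0) \<and> (\<forall>b\<in>B. (\<Sum>a\<in>A. c a * M b a) = 0)"
  using assms
proof (induction B arbitrary: A M rule: finite_induct)
  case empty
  then obtain a where "a \<in> A" by fastforce
  then show ?case by (intro exI[of _ "\<lambda>_. 1"]) auto
next
  case (insert b B)
  show ?case
  proof (cases "\<exists>a0\<in>A. M b a0 \<noteq> 0")
    case False
    then show ?thesis using insert.IH[of A M] insert by fastforce
  next
    case True
    then obtain a0 where a0: "a0 \<in> A" "M b a0 \<noteq> 0" by blast
    define A' where "A' = A - {a0}"
    define M' where "M' b' a = M b' a - M b' a0 * (M b a / M b a0)" for b' a
    have A': "finite A'" "a0 \<notin> A'" "A = insert a0 A'" using a0 insert.prems by (auto simp: A'_def)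
    have "card B < card A'" using insert A' by simp
    then obtain c where c: "\<exists>a\<in>A'. c a \<noteq> 0" "\<And>b'. b' \<in> B \<Longrightarrow> (\<Sum>a\<in>A'. c a * M' b' a) = 0"
      using insert.IH[of A' M'] A'(1) by blast
    \<comment> \<open>\<open>- k\<close> is the value of the unknown \<open>a0\<close> that makes
      equation \<open>b\<close> hold.\<close>
    define k where "k = (\<Sum>a\<in>A'. c a * M b a) / M b a0"
    define c' where "c' = c(a0 := - k)"
    have c': "(\<Sum>a\<in>A. c' a * M b' a) = (\<Sum>a\<in>A'. c a * M b' a) - k * M b' a0" for b'
    proof -
      have "(\<Sum>a\<in>A'. c' a * M b' a) = (\<Sum>a\<in>A'. c a * M b' a)"
        using A'(2) by (intro sum.cong) (auto simp: c'_def)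
      then show ?thesis using A' by (simp add: c'_def)
    qed
    have "(\<Sum>a\<in>A. c' a * M b' a) = 0" if b': "b' \<in> B" for b'
    proof -
      have "(\<Sum>a\<in>A'. c a * M' b' a) = (\<Sum>a\<in>A'. c a * M b' a) - (\<Sum>a\<in>A'. M b' a0 / M b a0 * (c a * M b a))"
        unfolding sum_subtractf[symmetric] by (intro sum.cong) (auto simp: M'_def algebra_simps)
      also have "\<dots> = (\<Sum>a\<in>A'. c a * M b' a) - k * M b' a0"
        unfolding sum_distrib_left[symmetric] by (simp add: k_def)
      finally show ?thesis using c' c(2)[OF b'] by simp
    qed
    moreover have "(\<Sum>a\<in>A. c' a * M b a) = 0" using c' a0(2) by (simp add: k_def)
    moreover have "\<exists>a\<in>A. c' a \<noteq> 0" using c(1) A' by (auto simp: c'_def)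
    ultimately show ?thesis by blast
  qed
qed

section \<open>Recursion between consecutive layers\<close>

lemma of_nat_mult_binomial_pred:
  "real y * real (y - 1 choose m) = (real y - real m) * real (y choose m)"
proof (cases "y < m \<or> y = 0")
  case True
  then show ?thesis by (cases y) (auto simp: binomial_eq_0)
next
  case False
  then have "y * (y - 1 choose m) = (y - m) * (y choose m)"
    using binomial_absorb_comp[of y m] by simp
  with False show ?thesis by (metis not_less of_nat_diff of_nat_mult)
qed

text \<open>A discrete form of Euler's identity for homogeneous functions: the factor
  \<open>y j\<close> turns the binomial coefficient at \<open>y j - 1\<close> into
  \<open>y j - m j\<close> times the one at \<open>y j\<close>, and these multipliers add up to the
  weight of \<open>y\<close> minus \<open>i\<close>.\<close>

lemma sum_lower_neighbours:
  fixes c :: "('a \<Rightarrow> nat) \<Rightarrow> real"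
  assumes "finite I" "\<And>m. m \<in> A \<Longrightarrow> sum m I = i"
  defines "f \<equiv> \<lambda>x. \<Sum>m\<in>A. c m * (\<Prod>j\<in>I. real (x j choose m j))"
  shows "(\<Sum>j\<in>I. real (y j) * f (y(j := y j - 1))) = (real (sum y I) - real i) * f y"
proof -
  have pj: "real (y j) * (\<Prod>l\<in>I. real ((y(j := y j - 1)) l choose m l)) =
      (real (y j) - real (m j)) * (\<Prod>l\<in>I. real (y l choose m l))" if j: "j \<in> I" for j and m :: "'a \<Rightarrow> nat"
  proof -
    have "(\<Prod>l\<in>I - {j}. real ((y(j := y j - 1)) l choose m l)) = (\<Prod>l\<in>I - {j}. real (y l choose m l))"
      by (intro prod.cong) auto
    then show ?thesis
      using of_nat_mult_binomial_pred[of "y j" "m j"] assms(1) j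
      by (simp add: prod.remove[of I j] mult.assoc[symmetric])
  qed
  have "(\<Sum>j\<in>I. real (y j) * f (y(j := y j - 1))) =
      (\<Sum>m\<in>A. \<Sum>j\<in>I. c m * (real (y j) * (\<Prod>l\<in>I. real ((y(j := y j - 1)) l choose m l))))"
    unfolding f_def sum_distrib_left by (subst sum.swap) (simp add: mult.left_commute del: fun_upd_apply)
  also have "\<dots> = (\<Sum>m\<in>A. \<Sum>j\<in>I. (real (y j) - real (m j)) * (c m * (\<Prod>l\<in>I. real (y l choose m l))))"
    by (intro sum.cong refl) (simp only: pj mult.left_commute)
  also have "\<dots> = (\<Sum>m\<in>A. (real (sum y I) - real i) * (c m * (\<Prod>l\<in>I. real (y l choose m l))))"
    unfolding sum_distrib_right[symmetric] sum_subtractf of_nat_sum[symmetric]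
    by (intro sum.cong refl) (simp add: assms(2))
  finally show ?thesis by (simp add: f_def sum_distrib_left)
qed

text \<open>For \<open>x\<close> above layer \<open>l\<close>, induction makes the left side of
  \<open>sum_lower_neighbours\<close> zero. The factor \<open>sum x I - i\<close> is positive there
  because \<open>i \<le> l\<close>, so \<open>f x = 0\<close>.\<close>

lemma zero_upwards:
  fixes c :: "('a \<Rightarrow> nat) \<Rightarrow> real"
  assumes fin: "finite I" and A: "\<And>m. m \<in> A \<Longrightarrow> sum m I = i"
  defines "f \<equiv> \<lambda>x. \<Sum>m\<in>A. c m * (\<Prod>j\<in>I. real (x j choose m j))"
  assumes l: "i \<le> l" and zero: "\<And>x. x \<in> cells I b \<Longrightarrow> sum x I = l \<Longrightarrow> f x = 0"
    and "x \<in> cells I b" "l \<le> sum x I"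
  shows "f x = 0"
  using assms(6-)
proof (induction "sum x I - l" arbitrary: x)
  case 0
  then show ?case using zero by simp
next
  case (Suc r)
  have "real (x j) * f (x(j := x j - 1)) = 0" if j: "j \<in> I" for j
  proof (cases "x j = 0")
    case False
    have "x j \<le> b j" using Suc.prems(1) j by (auto simp: PiE_iff)
    then have "x(j := x j - 1) \<in> cells I b" using Suc.prems(1) j by (intro cells_upd_less) auto
    moreover have "Suc (sum (x(j := x j - 1)) I) = sum x I"
      using sum_fun_upd[OF fin j, of x "x j - 1"] False by (simp del: fun_upd_apply)
    ultimately show ?thesis using Suc.hyps Suc.prems by simp
  qed simp
  then have "(\<Sum>j\<in>I. real (x j) * f (x(j := x j - 1))) = 0"
    by (intro sum.neutral ballI)
  moreover have "(\<Sum>j\<in>I. real (x j) * f (x(j := x j - 1))) = (real (sum x I) - real i) * f x"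
    unfolding f_def by (rule sum_lower_neighbours[OF fin]) (rule A)
  ultimately have "(real (sum x I) - real i) * f x = 0" by simp
  moreover have "real i < real (sum x I)" using l Suc.hyps(2) unfolding of_nat_less_iff by linarith
  ultimately show ?case unfolding mult_eq_0_iff by linarith
qed

text \<open>The reflection of \<open>x\<close> to \<open>b - x\<close> is an involution of the box
  that exchanges the two layers.\<close>

lemma card_layer_reflect:
  assumes "s + t = sum b I"
  shows "card {x \<in> cells I b. sum x I = s} = card {x \<in> cells I b. sum x I = t}"
proof -
  define r where "r x = (\<lambda>i\<in>I. b i - x i)" for x :: "'a \<Rightarrow> nat"
  have r: "r x \<in> cells I b" "sum (r x) I + sum x I = sum b I" "r (r x) = x" if x: "x \<in> cells I b" for x
  proof -
    have le: "x i \<le> b i" if "i \<in> I" for i using x that by (auto simp: PiE_iff)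
    show "r x \<in> cells I b" by (auto simp: r_def)
    show "sum (r x) I + sum x I = sum b I"
      unfolding sum.distrib[symmetric] by (intro sum.cong) (auto simp: r_def le)
    show "r (r x) = x" using x le by (intro PiE_ext[of _ I "\<lambda>i. {0..b i}"]) (auto simp: r_def)
  qed
  show ?thesis
  proof (intro bij_betw_same_card[of r] bij_betwI[of r _ _ r])
    have *: "r x \<in> {x \<in> cells I b. sum x I = q}"
      if "x \<in> {x \<in> cells I b. sum x I = p}" "p + q = sum b I" for x p q
    proof -
      from that(1) have x: "x \<in> cells I b" "sum x I = p" by simp_all
      show ?thesis using r(1,2)[OF x(1)] x(2) that(2) by simp
    qed
    show "r \<in> {x \<in> cells I b. sum x I = s} \<rightarrow> {x \<in> cells I b. sum x I = t}"
      by (intro Pi_I *[OF _ assms])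
    show "r \<in> {x \<in> cells I b. sum x I = t} \<rightarrow> {x \<in> cells I b. sum x I = s}"
      by (intro Pi_I *[OF _ trans[OF add.commute assms]])
  qed (use r(3) in simp_all)
qed

text \<open>The number of coefficients exceeds the number of points on the layer \<open>N + 1 - i\<close>. A function
  annihilating this layer vanishes on all higher ones, and it cannot vanish on any further layer \<open>j\<close>,
  since it would then be zero on all weights \<open>\<ge> N - i\<close>, hence everywhere.\<close>

lemma ex_poly_fun_supported_in_middle:
  fixes n :: nat and b :: "nat \<Rightarrow> nat"
  defines "I \<equiv> {1..n}"
  assumes ij: "i \<le> j" "j + i \<le> sum b I"
    and card: "card {x \<in> cells I b. sum x I = sum b I + 1 - i} < card {x \<in> cells I b. sum x I = i}"
  shows "\<exists>f. poly_fun n i f \<and>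
      (\<forall>x\<in>cells I b. sum x I < i \<or> sum b I < sum x I + i \<longrightarrow> f x = 0) \<and>
      (\<exists>x\<in>cells I b. sum x I = j \<and> f x \<noteq> 0)"
proof -
  have fin: "finite I" by (simp add: I_def)
  define A where "A = {x \<in> cells I b. sum x I = i}"
  define B where "B = {x \<in> cells I b. sum x I = sum b I + 1 - i}"
  have finA: "finite A" "finite B" using finite_cells[OF fin, of b] by (auto simp: A_def B_def)
  have "card B < card A" using card by (simp add: A_def B_def)
  \<comment> \<open>The unknowns are the coefficients of the binomial products indexed by
    \<open>A\<close>; each point of \<open>B\<close> gives one equation.\<close>
  from ex_nontrivial_solution[OF finA(2,1) this, of "\<lambda>x m. \<Prod>j\<in>I. real (x j choose m j)"]
  obtain c where c: "\<exists>m\<in>A. c m \<noteq> 0" "\<forall>x\<in>B. (\<Sum>m\<in>A. c m * (\<Prod>j\<in>I. real (x j choose m j))) = 0"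
    by (elim exE conjE)
  define f where "f = (\<lambda>x. \<Sum>m\<in>A. c m * (\<Prod>j\<in>I. real (x j choose m j)))"
  have A: "sum m I = i" if "m \<in> A" for m using that by (simp add: A_def)
  have up: "f x = 0" if il: "i \<le> l" and zero: "\<And>x. x \<in> cells I b \<Longrightarrow> sum x I = l \<Longrightarrow> f x = 0"
    and x: "x \<in> cells I b" "l \<le> sum x I" for l x
    unfolding f_def
  proof (rule zero_upwards[OF fin])
    show "sum m I = i" if "m \<in> A" for m by (rule A[OF that])
    show "(\<Sum>m\<in>A. c m * (\<Prod>j\<in>I. real (y j choose m j))) = 0" if "y \<in> cells I b" "sum y I = l" for y
      using zero[OF that] by (simp add: f_def)
  qed (use il x in auto)
  have pf: "poly_fun n i f"
    unfolding f_def
  proof (intro poly_fun_sum poly_fun_cmult)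
    fix m assume "m \<in> A"
    have "poly_fun n (sum m I) (\<lambda>x. \<Prod>j\<in>I. real (x j choose m j))"
      by (intro poly_fun_prod poly_fun_binomial) (simp add: I_def)
    then show "poly_fun n i (\<lambda>x. \<Prod>j\<in>I. real (x j choose m j))" using A[OF \<open>m \<in> A\<close>] by simp
  qed
  \<comment> \<open>The product for \<open>m\<close> is nonzero only at points that dominate
    \<open>m\<close> coordinatewise, and among those only \<open>m\<close> itself has weight at most
    \<open>i\<close>.\<close>
  have prod0: "(\<Prod>j\<in>I. real (x j choose m j)) = 0"
    if m: "m \<in> A" and x: "x \<in> cells I b" "sum x I \<le> i" "x \<noteq> m" for x m
  proof -
    have "\<exists>u\<in>I. x u < m u"
    proof (rule ccontr)
      assume "\<not> (\<exists>u\<in>I. x u < m u)"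
      then have le: "m u \<le> x u" if "u \<in> I" for u using that by force
      have "x u = m u" if "u \<in> I" for u
      proof (rule ccontr)
        assume "x u \<noteq> m u"
        then have "sum m I < sum x I"
          using le that by (intro sum_strict_mono_ex1 fin) (auto intro!: bexI[of _ u] simp: order.strict_iff_order)
        with x(2) A[OF m] show False by simp
      qed
      then have "x = m" using m x(1) by (intro PiE_ext[of x I "\<lambda>i. {0..b i}" m]) (auto simp: A_def)
      with x(3) show False ..
    qed
    then show ?thesis using fin by (auto simp: prod_zero_iff)
  qed
  have low: "f x = 0" if x: "x \<in> cells I b" "sum x I < i" for x
  proof -
    have "x \<noteq> m" if "m \<in> A" for m using A[OF that] x(2) by auto
    then show ?thesis unfolding f_def using prod0 x by (intro sum.neutral ballI) simp
  qed
  \<comment> \<open>Since \<open>2 * i \<le> sum b I\<close>, the annihilated layer is not below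
    layer \<open>i\<close>, as \<open>up\<close> requires.\<close>
  have high: "f x = 0" if x: "x \<in> cells I b" "sum b I < sum x I + i" for x
  proof (rule up[OF _ _ x(1)])
    show "i \<le> sum b I + 1 - i" "sum b I + 1 - i \<le> sum x I" using ij x(2) by linarith+
    show "f y = 0" if "y \<in> cells I b" "sum y I = sum b I + 1 - i" for y
      using bspec[OF c(2), of y] that by (simp add: B_def f_def)
  qed
  from c(1) obtain m where m: "m \<in> A" "c m \<noteq> 0" by blast
  have mb: "m \<in> cells I b" "sum m I = i" using m by (auto simp: A_def)
  \<comment> \<open>Only the product belonging to \<open>m\<close> survives at \<open>m\<close>, so
    \<open>f m\<close> is the coefficient \<open>c m\<close>.\<close>
  have "f m = (\<Sum>l\<in>A. if l = m then c m else 0)"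
    unfolding f_def
  proof (intro sum.cong refl)
    fix l assume "l \<in> A"
    then show "c l * (\<Prod>j\<in>I. real (m j choose l j)) = (if l = m then c m else 0)"
      using prod0[of l m] mb by auto
  qed
  then have fm: "f m \<noteq> 0" using m finA by simp
  have "\<exists>x\<in>cells I b. sum x I = j \<and> f x \<noteq> 0"
  proof (rule ccontr)
    assume *: "\<not> (\<exists>x\<in>cells I b. sum x I = j \<and> f x \<noteq> 0)"
    \<comment> \<open>\<open>Suc i\<close> matches the degree bound \<open>i\<close> and also the
      weights from \<open>sum b I - i\<close> upwards, which all lie at or above layer
      \<open>j\<close>.\<close>
    have "f m = 0"
    proof (rule zero_if_zero_on_top[OF fin, where f = f and D = "Suc i" and b = b])
      show "diffs_vanish I (Suc i) f" unfolding I_def by (rule diffs_vanish_poly_fun[OF pf])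
      show "f x = 0" if x: "x \<in> cells I b" "sum b I < sum x I + Suc i" for x
      proof (rule up[OF ij(1) _ x(1)])
        show "j \<le> sum x I" using ij x(2) by linarith
      qed (use * in blast)
    qed (rule mb(1))
    with fm show False ..
  qed
  with pf low high show ?thesis by blast
qed

lemma poly_fun_prod_weights:
  assumes "finite W"
  shows "poly_fun n (card W) (\<lambda>x. \<Prod>e\<in>W. real (wt n x) - real e)"
proof -
  have "poly_fun n 1 (\<lambda>x. real (wt n x) + - real e)" for e
    by (intro poly_fun.add poly_fun_wt poly_fun.const)
  from poly_fun_prod[of W n "\<lambda>_. 1", OF this] show ?thesis by simp
qed

text \<open>Reflection carries the upper layer to layer \<open>i - 1\<close>, which lies in the
  strictly increasing half. For \<open>i = 0\<close> the layer beyond the maximal weight is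
  empty.\<close>

lemma card_weight_set_unimodal:
  assumes "strictly_unimodal n k" "2 * i \<le> grid_N n k"
  shows "card (weight_set n k {grid_N n k + 1 - i}) < card (weight_set n k {i})"
proof -
  let ?b = "\<lambda>i. k i - 1"
  let ?I = "{1..n}"
  have ws: "weight_set n k {t} = {x \<in> cells ?I ?b. sum x ?I = t}" for t
    by (auto simp: weight_set_def grid_def wt_def)
  have N: "grid_N n k = sum ?b ?I" by (simp add: grid_N_def)
  show ?thesis
  proof (cases i)
    case 0
    have "\<exists>x\<in>cells ?I ?b. sum x ?I = 0" by (rule ex_cells_sum) auto
    then have "card (weight_set n k {0}) > 0"
      unfolding ws using finite_cells[of ?I ?b] by (subst card_gt_0_iff) auto
    moreover have "weight_set n k {grid_N n k + 1} = {}"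
    proof -
      have "sum x ?I \<noteq> sum ?b ?I + 1" if "x \<in> cells ?I ?b" for x
        using sum_cells_le[OF that] by linarith
      then show ?thesis unfolding ws N by blast
    qed
    ultimately show ?thesis using 0 by simp
  next
    case (Suc i')
    have "card (weight_set n k {grid_N n k + 1 - i}) = card (weight_set n k {i'})"
      unfolding ws using assms(2) Suc N by (intro card_layer_reflect) auto
    moreover have "\<forall>j<grid_N n k div 2. card (weight_set n k {j}) < card (weight_set n k {Suc j})"
      using assms(1) unfolding strictly_unimodal_def Let_def by blast
    then have "card (weight_set n k {i'}) < card (weight_set n k {Suc i'})"
      using assms(2) Suc by simp
    ultimately show ?thesis using Suc by simp
  qed
qed

section \<open>Certifying degree and polynomial covering\<close>

text \<open>The bridge between the combinatorial condition and polynomials. The bound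
  \<open>d \<le> N\<close> in the first part keeps \<open>T_set N i\<close> inside
  \<open>{0..N}\<close>.\<close>

lemma admitting_iff_ex_mpoly:
  assumes "strictly_unimodal n k" "E \<subset> {0..grid_N n k}"
  defines "N \<equiv> grid_N n k"
  shows "(d \<le> N \<longrightarrow> admitting N d E \<longrightarrow>
      (\<exists>P\<in>mpolys n. total_degree P \<le> d \<and> (\<forall>x\<in>weight_set n k E. grid_eval P x = 0) \<and>
        (\<exists>x\<in>grid n k. grid_eval P x \<noteq> 0)))" (is ?upper)
    and "P \<in> mpolys n \<Longrightarrow> total_degree P \<le> d \<Longrightarrow> \<forall>x\<in>weight_set n k E. grid_eval P x = 0 \<Longrightarrow>
      \<exists>x\<in>grid n k. grid_eval P x \<noteq> 0 \<Longrightarrow> admitting N d E"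
proof -
  let ?b = "\<lambda>i. k i - 1"
  let ?I = "{1..n}"
  have gr: "grid n k = cells ?I ?b" by (simp add: grid_def)
  have N: "N = sum ?b ?I" by (simp add: N_def grid_N_def)
  have wt: "wt n x = sum x ?I" for x by (simp add: wt_def)
  have ws: "weight_set n k F = {x \<in> cells ?I ?b. sum x ?I \<in> F}" for F
    by (simp add: weight_set_def gr wt)
  have EN: "E \<subseteq> {0..N}" using assms(2) by (simp add: N_def psubset_imp_subset)
  show ?upper
  proof (intro impI)
    assume dN: "d \<le> N" and "admitting N d E"
    then obtain i where "i \<in> {0..d}"
      and i2: "E \<union> T_set N i \<noteq> {0..N}" "card (E - T_set N i) \<le> d - i"
      unfolding admitting_def admitting_at_def by (elim bexE conjE)
    then have i: "i \<le> d" by simp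
    have "T_set N i \<subseteq> {0..N}" using dN i by (auto simp: T_set_def)
    \<comment> \<open>The missed weight \<open>j\<close> lies in the middle window; the polynomial
      is made nonzero at a point of this weight.\<close>
    with i2(1) EN obtain j where "j \<in> {0..N}" "j \<notin> E" "j \<notin> T_set N i" by blast
    then have j: "i \<le> j" "j + i \<le> N" "j \<notin> E" by (auto simp: T_set_def)
    have "card (weight_set n k {N + 1 - i}) < card (weight_set n k {i})"
      unfolding N_def by (rule card_weight_set_unimodal[OF assms(1)]) (use j in \<open>simp add: N_def\<close>)
    then have card: "card {x \<in> cells ?I ?b. sum x ?I = sum ?b ?I + 1 - i} < card {x \<in> cells ?I ?b. sum x ?I = i}"
      by (simp add: ws N)
    have "\<exists>f. poly_fun n i f \<and>
        (\<forall>x\<in>cells ?I ?b. sum x ?I < i \<or> sum ?b ?I < sum x ?I + i \<longrightarrow> f x = 0) \<and>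
        (\<exists>x\<in>cells ?I ?b. sum x ?I = j \<and> f x \<noteq> 0)"
      using j card by (intro ex_poly_fun_supported_in_middle) (simp_all add: N)
    then obtain f where f: "poly_fun n i f"
      "\<forall>x\<in>cells ?I ?b. sum x ?I < i \<or> N < sum x ?I + i \<longrightarrow> f x = 0"
      "\<exists>x\<in>cells ?I ?b. sum x ?I = j \<and> f x \<noteq> 0" unfolding N by (elim exE conjE)
    have fin: "finite (E - T_set N i)" using finite_subset[OF EN] by simp
    \<comment> \<open>The factor \<open>f\<close> takes care of the weights in
      \<open>T_set N i\<close> and the linear factors of the rest of \<open>E\<close>; neither kills
      every point of weight \<open>j\<close>.\<close>
    define g where "g = (\<lambda>x. f x * (\<Prod>e\<in>E - T_set N i. real (wt n x) - real e))"
    have "poly_fun n (i + card (E - T_set N i)) g"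
      unfolding g_def by (intro poly_fun_mult f poly_fun_prod_weights fin)
    then have "poly_fun n d g" by (rule poly_fun_mono) (use i i2(2) in simp)
    then obtain P where P: "P \<in> mpolys n" "total_degree P \<le> d" "\<And>x. grid_eval P x = g x"
      using ex_mpoly_if_poly_fun by blast
    have "g x = 0" if x: "x \<in> weight_set n k E" for x
    proof -
      from x have xc: "x \<in> cells ?I ?b" and xE: "sum x ?I \<in> E" by (simp_all add: ws)
      show ?thesis
      proof (cases "sum x ?I \<in> T_set N i")
        case True
        then have "sum x ?I < i \<or> N < sum x ?I + i" by (auto simp: T_set_def)
        with f(2) xc have "f x = 0" by blast
        then show ?thesis by (simp add: g_def)
      next
        case False
        with xE have "\<exists>e\<in>E - T_set N i. real (wt n x) - real e = 0"
          by (intro bexI[of _ "sum x ?I"]) (simp_all add: wt)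
        then have "(\<Prod>e\<in>E - T_set N i. real (wt n x) - real e) = 0" using fin by (simp add: prod_zero_iff)
        then show ?thesis by (simp add: g_def)
      qed
    qed
    moreover have "\<exists>x\<in>grid n k. g x \<noteq> 0"
    proof -
      from f(3) obtain x where x: "x \<in> cells ?I ?b" "sum x ?I = j" "f x \<noteq> 0" by blast
      have "(\<Prod>e\<in>E - T_set N i. real (wt n x) - real e) \<noteq> 0"
        using fin j(3) x(2) by (auto simp: prod_zero_iff wt)
      with x show ?thesis unfolding gr by (intro bexI[of _ x]) (simp_all add: g_def)
    qed
    ultimately show "\<exists>P\<in>mpolys n. total_degree P \<le> d \<and> (\<forall>x\<in>weight_set n k E. grid_eval P x = 0) \<and>
        (\<exists>x\<in>grid n k. grid_eval P x \<noteq> 0)" using P(1,2) by (intro bexI[of _ P]) (simp_all add: P(3))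
  qed
  show "admitting N d E"
    if P: "P \<in> mpolys n" "total_degree P \<le> d" "\<forall>x\<in>weight_set n k E. grid_eval P x = 0"
      "\<exists>x\<in>grid n k. grid_eval P x \<noteq> 0"
  proof -
    have "diffs_vanish ?I (Suc d) (grid_eval P)"
      by (intro diffs_vanish_poly_fun poly_fun_grid_eval P)
    moreover obtain x0 where x0: "x0 \<in> cells ?I ?b" "grid_eval P x0 \<noteq> 0"
      using P(4) unfolding gr by blast
    moreover have "grid_eval P x = 0" if "x \<in> cells ?I ?b" "sum x ?I \<in> E" for x
      using P(3) that by (simp add: ws)
    ultimately have "\<exists>i j. i \<le> j \<and> j + i \<le> N \<and> j \<notin> E \<and> card (E \<inter> {i..N - i}) + i \<le> d"
      unfolding N by (intro zero_weights_bound[where f = "grid_eval P" and ?x0.0 = x0]) auto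
    then obtain i j where ij: "i \<le> j" "j + i \<le> N" "j \<notin> E" "card (E \<inter> {i..N - i}) + i \<le> d"
      by (elim exE conjE)
    \<comment> \<open>Inside \<open>{0..N}\<close> the complement of \<open>T_set N i\<close> is the
      window \<open>{i..N - i}\<close>; the witness \<open>j\<close> ensures
      \<open>i \<le> N\<close>, so the subtractions do not truncate.\<close>
    have "E - T_set N i = E \<inter> {i..N - i}"
    proof
      show "E - T_set N i \<subseteq> E \<inter> {i..N - i}"
      proof
        fix e assume e: "e \<in> E - T_set N i"
        with EN have "e \<le> N" by auto
        with e show "e \<in> E \<inter> {i..N - i}" by (auto simp: T_set_def)
      qed
      show "E \<inter> {i..N - i} \<subseteq> E - T_set N i" using ij(1,2) by (auto simp: T_set_def)
    qed
    with ij(4) have "card (E - T_set N i) \<le> d - i" "i \<in> {0..d}" by simp_all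
    moreover have "j \<notin> E \<union> T_set N i" "j \<in> {0..N}" using ij(1-3) by (auto simp: T_set_def)
    then have "E \<union> T_set N i \<noteq> {0..N}" by blast
    ultimately show ?thesis
      unfolding admitting_def admitting_at_def by blast
  qed
qed

text \<open>A point of \<open>S\<close> supplies the value zero, which together with a nonzero value
  rules out constancy on the grid.\<close>

lemma certifying_if_vanishing:
  assumes "P \<in> mpolys n" "\<forall>x\<in>S. grid_eval P x = 0" "\<exists>x\<in>grid n k. grid_eval P x \<noteq> 0"
    and "S \<noteq> {}" "S \<subseteq> grid n k"
  shows "certifying n k S P"
proof -
  obtain s where s: "s \<in> S" using assms(4) by blast
  have "\<not> grid_eval P constant_on grid n k"
    using assms(2,3,5) s unfolding constant_on_def by (metis subsetD)
  then show ?thesis using assms(1,2) unfolding certifying_def constant_on_def by blast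
qed

text \<open>Subtracting the constant value on \<open>S\<close> keeps the degree bound, and
  nonconstancy supplies a grid point where the difference is nonzero.\<close>

lemma vanishing_if_certifying:
  assumes "certifying n k S f"
  shows "\<exists>P\<in>mpolys n. total_degree P \<le> total_degree f \<and> (\<forall>x\<in>S. grid_eval P x = 0) \<and>
    (\<exists>x\<in>grid n k. grid_eval P x \<noteq> 0)"
proof -
  obtain y where y: "\<forall>x\<in>S. grid_eval f x = y"
    using assms unfolding certifying_def constant_on_def by blast
  have "f \<in> mpolys n" using assms by (simp add: certifying_def)
  then have "poly_fun n (total_degree f) (\<lambda>x. grid_eval f x + - y)"
    by (intro poly_fun.add poly_fun.const poly_fun_grid_eval) auto
  then obtain P where P: "P \<in> mpolys n" "total_degree P \<le> total_degree f" "\<And>x. grid_eval P x = grid_eval f x + - y"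
    using ex_mpoly_if_poly_fun by blast
  have "\<exists>x\<in>grid n k. grid_eval f x \<noteq> y"
    using assms unfolding certifying_def constant_on_def by blast
  with P y show ?thesis by (intro bexI[of _ P]) auto
qed

theorem theorem1p16:
  fixes n :: nat and k :: "nat \<Rightarrow> nat" and E :: "nat set"
  assumes "uniform_grid n k"
    and "strictly_unimodal n k"
    and "E \<subset> {0..grid_N n k}"
  shows "(E \<noteq> {} \<longrightarrow> cert_deg n k (weight_set n k E) = PC n k E) \<and>
         PC n k E = Min {d \<in> {0..grid_N n k}. admitting (grid_N n k) d E}"
proof -
  let ?N = "grid_N n k"
  let ?S = "weight_set n k E"
  define V where "V P \<longleftrightarrow> P \<in> mpolys n \<and> (\<forall>x\<in>?S. grid_eval P x = 0) \<and> (\<exists>x\<in>grid n k. grid_eval P x \<noteq> 0)" for P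
  have upper: "\<exists>P. V P \<and> total_degree P \<le> d" if "admitting ?N d E" "d \<le> ?N" for d
    using admitting_iff_ex_mpoly(1)[OF assms(2,3), of d] that unfolding V_def by blast
  have lower: "admitting ?N (total_degree P) E" if "V P" for P
    using admitting_iff_ex_mpoly(2)[OF assms(2,3), of P "total_degree P"] that unfolding V_def by blast
  have PC: "PC n k E = (LEAST d. \<exists>P. V P \<and> total_degree P = d)"
    unfolding PC_def V_def by (rule arg_cong[where f = Least]) auto
  have "card E < card {0..?N}" using assms(3) by (intro psubset_card_mono) auto
  \<comment> \<open>The choice \<open>i = 0\<close> works: \<open>T_set ?N 0\<close> is empty, and
    \<open>E\<close>, being a proper subset, has at most \<open>?N\<close> elements.\<close>
  then have N: "admitting ?N ?N E"
    unfolding admitting_def using assms(3) by (intro bexI[of _ 0]) (auto simp: admitting_at_def T_set_def)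
  obtain P where "V P" using upper[OF N] by blast
  then have "\<exists>d P. V P \<and> total_degree P = d" by blast
  then have "\<exists>P. V P \<and> total_degree P = PC n k E"
    unfolding PC by (rule LeastI_ex)
  then obtain P0 where P0: "V P0" "total_degree P0 = PC n k E" by blast
  have PC_le: "PC n k E \<le> total_degree P" if "V P" for P
    unfolding PC by (rule Least_le) (use that in blast)
  have PC_le': "PC n k E \<le> d" if "admitting ?N d E" "d \<le> ?N" for d
    using upper[OF that] PC_le by (meson order_trans)
  \<comment> \<open>This places the minimal degree in the range \<open>{0..?N}\<close> over which
    the other two minima are taken.\<close>
  have PCN: "PC n k E \<le> ?N" using PC_le'[OF N] by simp
  have "Min {d \<in> {0..?N}. admitting ?N d E} = PC n k E"
  proof (rule Min_eqI)
    show "PC n k E \<in> {d \<in> {0..?N}. admitting ?N d E}"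
      using PCN lower[OF P0(1)] P0(2) by simp
    show "PC n k E \<le> d" if "d \<in> {d \<in> {0..?N}. admitting ?N d E}" for d
      using that by (intro PC_le') simp_all
  qed simp
  \<comment> \<open>Nonemptiness of \<open>E\<close> puts a point into \<open>?S\<close>, so a
    polynomial vanishing on \<open>?S\<close> but not on the grid is nonconstant. For empty
    \<open>E\<close> a nonzero constant attains degree 0 in \<open>PC\<close> but certifies
    nothing.\<close>
  moreover have "cert_deg n k ?S = PC n k E" if E: "E \<noteq> {}"
  proof -
    obtain e where e: "e \<in> E" "e \<le> ?N" using E assms(3) by fastforce
    then obtain x where "x \<in> cells {1..n} (\<lambda>i. k i - 1)" "sum x {1..n} = e"
      using ex_cells_sum[of "{1..n}" e "\<lambda>i. k i - 1"] unfolding grid_N_def by blast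
    then have "x \<in> ?S" using e(1) by (simp add: weight_set_def grid_def wt_def)
    then have S: "?S \<noteq> {}" by blast
    have "?S \<subseteq> grid n k" by (auto simp: weight_set_def)
    with S have "certifying n k ?S P0"
      using P0(1) unfolding V_def by (elim conjE) (rule certifying_if_vanishing)
    with P0(2) PCN have "PC n k E \<in> {0..?N} \<and> (\<exists>f. certifying n k ?S f \<and> total_degree f \<le> PC n k E)"
      by auto
    then show ?thesis
      unfolding cert_deg_def
    proof (rule Least_equality)
      fix d assume "d \<in> {0..?N} \<and> (\<exists>f. certifying n k ?S f \<and> total_degree f \<le> d)"
      then obtain f where f: "certifying n k ?S f" "total_degree f \<le> d" by blast
      then obtain P where "V P" "total_degree P \<le> total_degree f"
        using vanishing_if_certifying[OF f(1)] unfolding V_def by blast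
      with PC_le f(2) show "PC n k E \<le> d" by (meson order_trans)
    qed
  qed
  ultimately show ?thesis by simp
qed

end
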